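(* Let $U=\{0,1,\dots,|U|-1\}$ with $|U|>1$, and let $k\ge 2$ be an integer. Consider the following randomized construction. Let $u,d$ be the unique positive integers with $2^{u-1}<|U|\le 2^u$ and $2^{d-1}<\frac{k}{\ln k}\le 2^d$. Choose $f$ uniformly at random from a $\lceil 12\ln k\rceil$-wise independent family of hash functions $\{0,1\}^u\to\{0,1\}^d$. Let $\mathcal{H}'$ be a universal family of hash functions from $U$ to $\{0,1,\dots,\lceil 13\ln k\rceil^2-1\}$, and for each $i\in\{0,\dots,2^d-1\}$ let $F_i$ be a set of $\lceil 8\ln k\rceil$ hash functions chosen independently and uniformly at random from $\mathcal{H}'$, with an arbitrary fixed ordering. Set $d_1=2^d$, $d_2=\lceil 8\ln k\rceil$, $d_3=\lceil 13\ln k\rceil^2$. For $x\in U$, let $j$ be the integer whose $d$-bit binary representation equals $f(\mathrm{bin}(x))$, where $\mathrm{bin}(x)$ is the $u$-bit binary representation of $x$; let $h_i$ be the $i$-th function of $F_j$; and define $$\mathcal{G}(x)=\{\,j\cdot d_2 d_3+(i-1)\cdot d_3+h_i(x)\;:\; i=1,\dots,d_2\,\}.$$ For $a\in\{0,\dots,d_1d_2d_3-1\}$ let $T_a=\{x\in U: a\in\mathcal{G}(x)\}$. Then for any subset $S\subseteq U$ with $|S|=k$, with probability at least $1-\frac{4}{k^3\ln k}$ (over the random choices of $f$ and $F_0,\dots,F_{d_1-1}$) there exist $k$ sets $T_{i_0},\dots,T_{i_{k-1}}$ such that: (1) $|T_{i_j}\cap S|=1$ for every $j\in\{0,\dots,k-1\}$;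 (2) $S\subseteq\bigcup_{j=0}^{k-1}T_{i_j}$; and (3) $T_{i_j}\cap T_{i_l}=\emptyset$ for all $j\neq l$ in $\{0,\dots,k-1\}$.
   Context: A family $\mathcal{H}$ of functions from a universe to $\{0,\dots,r-1\}$ is universal if for every pair of distinct keys $x\neq y$, $\Pr_{h}[h(x)=h(y)]\le 1/r$ for $h$ chosen uniformly at random from $\mathcal{H}$. A family is $\kappa$-wise independent if for any $\kappa$ distinct keys $x_1,\dots,x_\kappa$ and any values $a_1,\dots,a_\kappa$ in the range of size $r$, $\Pr_h[h(x_1)=a_1\wedge\cdots\wedge h(x_\kappa)=a_\kappa]=r^{-\kappa}$. *)

theory Defs
  imports "HOL-Probability.Probability"
begin

text \<open>
  A family of hash functions is a nonempty finite multiset of functions: parametrised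
  families may contain the same function several times, and a uniformly random member is
  drawn with these multiplicities. A family without repetitions \<open>A\<close> is \<open>mset_set A\<close>.
  Values outside the key set \<open>X\<close> are unconstrained and irrelevant.
\<close>

definition hash_family :: "'a set \<Rightarrow> 'b set \<Rightarrow> ('a \<Rightarrow> 'b) multiset \<Rightarrow> bool" where
  "hash_family X R H \<longleftrightarrow> H \<noteq> {#} \<and> (\<forall>h\<in>#H. h \<in> X \<rightarrow> R)"

definition universal_family :: "'a set \<Rightarrow> nat \<Rightarrow> ('a \<Rightarrow> nat) multiset \<Rightarrow> bool" where
  "universal_family X r H \<longleftrightarrow>
     hash_family X {..<r} H \<and>
     (\<forall>x\<in>X. \<forall>y\<in>X. x \<noteq> y \<longrightarrow>
        measure_pmf.prob (pmf_of_multiset H) {h. h x = h y} \<le> 1 / real r)"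

definition kwise_independent_family ::
    "nat \<Rightarrow> 'a set \<Rightarrow> 'b set \<Rightarrow> ('a \<Rightarrow> 'b) multiset \<Rightarrow> bool" where
  "kwise_independent_family \<kappa> X R H \<longleftrightarrow>
     hash_family X R H \<and>
     (\<forall>x a. inj_on x {..<\<kappa>} \<and> x \<in> {..<\<kappa>} \<rightarrow> X \<and> a \<in> {..<\<kappa>} \<rightarrow> R \<longrightarrow>
        measure_pmf.prob (pmf_of_multiset H) {h. \<forall>i<\<kappa>. h (x i) = a i}
          = 1 / real (card R) ^ \<kappa>)"

definition bitstrings :: "nat \<Rightarrow> bool list set" where
  "bitstrings m = {bs. length bs = m}"

text \<open>Most significant bit first.\<close>

definition bin :: "nat \<Rightarrow> nat \<Rightarrow> bool list" where
  "bin m x = map (bit x) (rev [0..<m])"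

definition unbin :: "bool list \<Rightarrow> nat" where
  "unbin bs = horner_sum of_bool 2 (rev bs)"

lemma bin_eq_iff_unbin:
  assumes "bs \<in> bitstrings m" "j < 2 ^ m"
  shows "bin m j = bs \<longleftrightarrow> j = unbin bs"
proof
  assume "bin m j = bs"
  then have "rev bs = map (bit j) [0..<m]"
    by (auto simp: bin_def rev_map)
  then show "j = unbin bs"
    using assms(2) by (simp add: unbin_def horner_sum_bit_eq_take_bit take_bit_nat_eq_self)
next
  assume "j = unbin bs"
  then show "bin m j = bs"
    using assms(1)
    by (intro nth_equalityI)
       (auto simp: bin_def unbin_def bitstrings_def rev_nth bit_horner_sum_bit_iff)
qed

text \<open>
  Here \<open>F j\<close> is the ordered list of the \<open>d\<^sub>2\<close> functions belonging to bucket \<open>j\<close>; list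
  positions start at \<open>0\<close>, whereas \<open>i\<close> ranges over \<open>1, \<dots>, d\<^sub>2\<close>.
\<close>

definition G :: "nat \<Rightarrow> nat \<Rightarrow> nat \<Rightarrow> (bool list \<Rightarrow> bool list)
    \<Rightarrow> (nat \<Rightarrow> (nat \<Rightarrow> nat) list) \<Rightarrow> nat \<Rightarrow> nat set" where
  "G u d2 d3 f F x =
     (let j = unbin (f (bin u x))
      in (\<lambda>i. j * d2 * d3 + (i - 1) * d3 + (F j ! (i - 1)) x) ` {1..d2})"

definition T :: "nat \<Rightarrow> nat \<Rightarrow> nat \<Rightarrow> nat \<Rightarrow> (bool list \<Rightarrow> bool list)
    \<Rightarrow> (nat \<Rightarrow> (nat \<Rightarrow> nat) list) \<Rightarrow> nat \<Rightarrow> nat set" where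
  "T n u d2 d3 f F a = {x \<in> {..<n}. a \<in> G u d2 d3 f F x}"

text \<open>
  The joint distribution of \<open>f\<close> and of the draws \<open>F\<^sub>0, \<dots>, F\<^bsub>d\<^sub>1-1\<^esub>\<close>: all of them are
  independent, and each \<open>F\<^sub>j\<close> consists of \<open>d\<^sub>2\<close> independent uniform draws (with replacement).
\<close>

definition construction_pmf :: "(bool list \<Rightarrow> bool list) multiset \<Rightarrow> (nat \<Rightarrow> nat) multiset
    \<Rightarrow> nat \<Rightarrow> nat \<Rightarrow> ((bool list \<Rightarrow> bool list) \<times> (nat \<Rightarrow> (nat \<Rightarrow> nat) list)) pmf" where
  "construction_pmf HF H' d1 d2 =
     pair_pmf (pmf_of_multiset HF)
       (Pi_pmf {..<d1} [] (\<lambda>_. replicate_pmf d2 (pmf_of_multiset H')))"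

end

theory Submission
  imports Defs
begin

text \<open>
  Call \<open>f\<close> overloaded if it sends \<open>\<kappa> = \<lceil>12 ln k\<rceil>\<close> keys of \<open>S\<close> to one bucket. A union bound over the
  \<open>\<kappa>\<close>-subsets of \<open>S\<close> bounds the probability of this by
  \<open>d\<^sub>1 (k choose \<kappa>) / d\<^sub>1\<^sup>\<kappa> \<le> d\<^sub>1 (ln k)\<^sup>\<kappa> / \<kappa>! \<le> d\<^sub>1 e\<^sup>-\<^sup>\<kappa>\<close>, without a sharper tail inequality. If \<open>f\<close> is not
  overloaded, every bucket holds fewer than \<open>\<lceil>13 ln k\<rceil>\<close> keys, so a member of the universal family
  is injective on it with probability at least \<open>1/2\<close>, and all \<open>d\<^sub>2\<close> draws fail with probability at
  most \<open>2\<close> to the power \<open>- 8 ln k\<close>. When every bucket has a function injective on its keys, the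
  cells of these functions that are occupied by \<open>S\<close> are the required sets.
\<close>

section \<open>Elementary exponential estimates\<close>

text \<open>A single term is at most the sum of a nonnegative series. At \<open>x = n\<close> this
  gives \<open>n ^ n / fact n \<le> exp n\<close>, which serves in place of Stirling's
  formula.\<close>

lemma power_div_fact_le_exp:
  fixes x :: real
  assumes "x \<ge> 0"
  shows "x ^ n / fact n \<le> exp x"
proof -
  have "(\<Sum>i\<in>{n}. x ^ i /\<^sub>R fact i) \<le> (\<Sum>i. x ^ i /\<^sub>R fact i)"
    using assms by (intro sum_le_suminf summable_exp_generic) auto
  then show ?thesis
    by (simp add: exp_def divide_inverse mult.commute)
qed

text \<open>Here \<open>N\<close> is the number of buckets and \<open>L\<close> is
  \<open>ln k\<close>. The binomial is at most \<open>k ^ \<kappa> / fact \<kappa>\<close>, and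
  \<open>k / N \<le> \<kappa> / 12\<close>. The series bound then costs \<open>exp \<kappa>\<close>,
  while \<open>12 \<ge> exp 2\<close> gains \<open>exp (- 2 * \<kappa>)\<close>.\<close>

lemma binomial_div_power_le_exp:
  fixes N L :: real
  assumes "N > 0" "real k \<le> L * N" "12 * L \<le> real \<kappa>"
  shows "real (k choose \<kappa>) / N ^ \<kappa> \<le> exp (- real \<kappa>)"
proof -
  have exp2: "exp 2 \<le> (12 :: real)"
  proof -
    have "exp 2 = (exp 1 :: real) ^ 2"
      by (simp flip: exp_of_nat_mult)
    also have "\<dots> \<le> 3 ^ 2"
      by (intro power_mono exp_le) auto
    finally show ?thesis by simp
  qed
  have "L * N \<le> real \<kappa> / 12 * N"
    using assms by (intro mult_right_mono) auto
  then have "real k \<le> real \<kappa> / 12 * N"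
    using assms(2) by linarith
  then have "real k / N \<le> real \<kappa> / 12"
    using assms(1) by (simp add: divide_le_eq)
  then have kN: "(real k / N) ^ \<kappa> \<le> (real \<kappa> / 12) ^ \<kappa>"
    using assms by (intro power_mono) auto
  have "real (k choose \<kappa>) * fact \<kappa> \<le> real k ^ \<kappa>"
    using binomial_fact_pow[of k \<kappa>] by (metis of_nat_le_iff of_nat_mult of_nat_power of_nat_fact)
  then have "real (k choose \<kappa>) / N ^ \<kappa> \<le> (real k / N) ^ \<kappa> / fact \<kappa>"
    using assms by (simp add: field_simps)
  also have "\<dots> \<le> (real \<kappa> / 12) ^ \<kappa> / fact \<kappa>"
    using kN by (intro divide_right_mono) auto
  also have "\<dots> = (real \<kappa> ^ \<kappa> / fact \<kappa>) / 12 ^ \<kappa>"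
    by (simp add: field_simps)
  also have "\<dots> \<le> exp (real \<kappa>) / 12 ^ \<kappa>"
    by (intro divide_right_mono power_div_fact_le_exp) auto
  also have "\<dots> \<le> exp (real \<kappa>) / exp 2 ^ \<kappa>"
    using exp2 by (intro divide_left_mono power_mono) auto
  also have "\<dots> = exp (- real \<kappa>)"
    by (simp flip: exp_of_nat_mult exp_diff)
  finally show ?thesis .
qed

text \<open>Since \<open>exp 1 \<le> 4\<close>, its square root is at most \<open>2\<close>, so
  \<open>m\<close> halvings gain at least \<open>exp (m / 2)\<close>. For \<open>L = ln k\<close>
  the bound is \<open>1 / k ^ 4\<close>.\<close>

lemma half_power_le_exp:
  fixes L :: real
  assumes "8 * L \<le> real m"
  shows "(1 / 2) ^ m \<le> exp (- 4 * L)"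
proof -
  have "exp (1 / 2) ^ 2 = (exp 1 :: real)"
    by (simp flip: exp_of_nat_mult)
  then have "exp (1 / 2) ^ 2 \<le> (2 :: real) ^ 2"
    using exp_le by simp
  then have "exp (1 / 2) \<le> (2 :: real)"
    by (rule power2_le_imp_le) simp
  then have "exp (1 / 2) ^ m \<le> (2 :: real) ^ m"
    by (intro power_mono) auto
  moreover have "exp (4 * L) \<le> exp (1 / 2) ^ m"
    using assms by (simp flip: exp_of_nat_mult)
  ultimately have "exp (4 * L) \<le> 2 ^ m"
    by linarith
  then show ?thesis
    by (simp add: exp_minus power_one_over field_simps)
qed

section \<open>Conditioning and union bounds for product distributions\<close>

lemma measure_bind_pmf:
  "measure_pmf.prob (bind_pmf M N) X = (\<integral>x. measure_pmf.prob (N x) X \<partial>measure_pmf M)"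
  unfolding measure_pmf_bind
  by (subst measure_pmf.measure_bind[where N = "count_space UNIV"]) 
    (auto simp: space_subprob_algebra measure_pmf.subprob_space_axioms)

text \<open>Condition on the first coordinate, with \<open>B\<close> as its failure event. The
  premise is confined to the support of \<open>A\<close>, because only there is a sampled function
  known to map keys into the range.\<close>

lemma prob_pair_pmf_le:
  assumes "\<And>x. x \<in> set_pmf A \<Longrightarrow> x \<notin> B \<Longrightarrow> measure_pmf.prob Q {y. (x, y) \<in> E} \<le> c" "c \<ge> 0"
  shows "measure_pmf.prob (pair_pmf A Q) E \<le> measure_pmf.prob A B + c"
proof -
  have "measure_pmf.prob (pair_pmf A Q) E
      = (\<integral>x. measure_pmf.prob Q {y. (x, y) \<in> E} \<partial>measure_pmf A)"
    by (simp add: pair_pmf_def map_pmf_def[symmetric] measure_bind_pmf measure_map_pmf vimage_def)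
  also have "\<dots> \<le> (\<integral>x. indicator B x + c \<partial>measure_pmf A)"
  proof (rule integral_mono_AE)
    show "integrable (measure_pmf A) (\<lambda>x. measure_pmf.prob Q {y. (x, y) \<in> E})"
      by (intro measure_pmf.integrable_const_bound[where B = 1]) auto
    show "integrable (measure_pmf A) (\<lambda>x. indicator B x + c)"
      by (intro Bochner_Integration.integrable_add integrable_real_indicator)
        (auto simp: less_top[symmetric])
    \<comment> \<open>For \<open>x\<close> in \<open>B\<close> the trivial bound \<open>1\<close> is
      used, and \<open>c \<ge> 0\<close> preserves it.\<close>
    show "AE x in measure_pmf A. measure_pmf.prob Q {y. (x, y) \<in> E} \<le> indicator B x + c"
      using assms by (auto simp: AE_measure_pmf_iff indicator_def intro: order_trans[OF measure_pmf.prob_le_1])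
  qed
  also have "\<dots> = measure_pmf.prob A B + c"
    by (subst Bochner_Integration.integral_add) 
      (auto simp: integrable_real_indicator less_top[symmetric])
  finally show ?thesis .
qed

text \<open>The draws are independent: the induction splits off the first one, whose indicator
  factors out of the integral.\<close>

lemma prob_replicate_pmf_all:
  "measure_pmf.prob (replicate_pmf m p) {xs. \<forall>x\<in>set xs. P x} = measure_pmf.prob p {x. P x} ^ m"
proof (induction m)
  case (Suc m)
  have "replicate_pmf (Suc m) p = bind_pmf p (\<lambda>x. map_pmf ((#) x) (replicate_pmf m p))"
    by (simp add: map_pmf_def)
  then have "measure_pmf.prob (replicate_pmf (Suc m) p) {xs. \<forall>x\<in>set xs. P x}
      = (\<integral>x. measure_pmf.prob (replicate_pmf m p) {xs. P x \<and> (\<forall>y\<in>set xs. P y)} \<partial>measure_pmf p)"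
    by (simp add: measure_bind_pmf measure_map_pmf vimage_def del: replicate_pmf.simps)
  also have "\<dots> = (\<integral>x. indicator {x. P x} x * measure_pmf.prob p {x. P x} ^ m \<partial>measure_pmf p)"
    by (intro Bochner_Integration.integral_cong) (auto simp: Suc indicator_def)
  finally show ?case
    by simp
qed auto

text \<open>Union bound over the coordinates, whose marginals are the \<open>p i\<close>.\<close>

lemma prob_Pi_pmf_ex_le:
  assumes "finite I" "\<And>i. i \<in> I \<Longrightarrow> measure_pmf.prob (p i) {x. P i x} \<le> c"
  shows "measure_pmf.prob (Pi_pmf I dflt p) {F. \<exists>i\<in>I. P i (F i)} \<le> real (card I) * c"
proof -
  have "{F. \<exists>i\<in>I. P i (F i)} = (\<Union>i\<in>I. {F. P i (F i)})"
    by auto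
  then have "measure_pmf.prob (Pi_pmf I dflt p) {F. \<exists>i\<in>I. P i (F i)}
      \<le> (\<Sum>i\<in>I. measure_pmf.prob (Pi_pmf I dflt p) {F. P i (F i)})"
    using assms(1) by (simp add: measure_pmf.finite_measure_subadditive_finite)
  also have "\<dots> \<le> (\<Sum>i\<in>I. c)"
  proof (rule sum_mono)
    fix i assume i: "i \<in> I"
    have "measure_pmf.prob (Pi_pmf I dflt p) {F. P i (F i)}
        = measure_pmf.prob (map_pmf (\<lambda>F. F i) (Pi_pmf I dflt p)) {x. P i x}"
      by (simp add: measure_map_pmf vimage_def)
    also have "map_pmf (\<lambda>F. F i) (Pi_pmf I dflt p) = p i"
      using assms(1) i by (simp add: Pi_pmf_component)
    finally show "measure_pmf.prob (Pi_pmf I dflt p) {F. P i (F i)} \<le> c"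
      using assms(2) i by simp
  qed
  finally show ?thesis by simp
qed

section \<open>Collisions in universal and independent families\<close>

lemma hash_family_set_pmf:
  assumes "hash_family X R H" "h \<in> set_pmf (pmf_of_multiset H)"
  shows "h \<in> X \<rightarrow> R"
  using assms by (auto simp: hash_family_def)

text \<open>Birthday bound: there are at most \<open>m\<^sup>2 / 2\<close> pairs, each colliding
  with probability at most \<open>1 / m\<^sup>2\<close>. The linear order presents an unordered pair
  as \<open>Min B\<close> and \<open>Max B\<close>, so each pair is counted once and the factor
  \<open>1 / 2\<close> survives.\<close>

lemma universal_family_not_inj_on_le:
  fixes A :: "'a :: linorder set"
  assumes "universal_family X (m\<^sup>2) H" "A \<subseteq> X" "finite A" "card A \<le> m"
  shows "measure_pmf.prob (pmf_of_multiset H) {h. \<not> inj_on h A} \<le> 1 / 2"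
proof -
  define Q where "Q = {B. B \<subseteq> A \<and> card B = 2}"
  have fin: "finite Q"
    using assms(3) by (simp add: Q_def)
  have "{h. \<not> inj_on h A} \<subseteq> (\<Union>B\<in>Q. {h. h (Min B) = h (Max B)})"
  proof
    fix h assume "h \<in> {h. \<not> inj_on h A}"
    then obtain x y where xy: "x \<in> A" "y \<in> A" "x < y" "h x = h y"
      by (auto simp: inj_on_def) (metis neqE)
    then show "h \<in> (\<Union>B\<in>Q. {h. h (Min B) = h (Max B)})"
      by (intro UN_I[of "{x, y}"]) (auto simp: Q_def)
  qed
  then have "measure_pmf.prob (pmf_of_multiset H) {h. \<not> inj_on h A}
      \<le> measure_pmf.prob (pmf_of_multiset H) (\<Union>B\<in>Q. {h. h (Min B) = h (Max B)})"
    by (intro measure_pmf.finite_measure_mono) auto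
  also have "\<dots> \<le> (\<Sum>B\<in>Q. measure_pmf.prob (pmf_of_multiset H) {h. h (Min B) = h (Max B)})"
    using fin by (intro measure_pmf.finite_measure_subadditive_finite) auto
  also have "\<dots> \<le> (\<Sum>B\<in>Q. 1 / real (m\<^sup>2))"
  proof (rule sum_mono)
    fix B assume B: "B \<in> Q"
    then obtain x y where xy: "B = {x, y}" "x \<noteq> y"
      by (auto simp: Q_def card_2_iff)
    then have "Min B \<in> X" "Max B \<in> X" "Min B \<noteq> Max B"
      using B assms(2) by (auto simp: Q_def min_def max_def)
    then show "measure_pmf.prob (pmf_of_multiset H) {h. h (Min B) = h (Max B)} \<le> 1 / real (m\<^sup>2)"
      using assms(1) by (auto simp: universal_family_def)
  qed
  also have "\<dots> = real (card A choose 2) / real (m\<^sup>2)"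
    using n_subsets[OF assms(3), of 2] by (simp add: Q_def)
  also have "\<dots> \<le> 1 / 2"
  proof -
    have "2 * (card A choose 2) \<le> card A * (card A - 1)"
      by (simp add: choose_two)
    also have "\<dots> \<le> m * m"
      using assms(4) by (intro mult_mono) auto
    finally have "2 * real (card A choose 2) \<le> real (m\<^sup>2)"
      by (metis of_nat_le_iff of_nat_mult of_nat_numeral power2_eq_square)
    then show ?thesis
      by (cases "m = 0") (auto simp: field_simps)
  qed
  finally show ?thesis .
qed

text \<open>Independence is defined for sequences of distinct keys; enumerating \<open>B\<close>
  transfers it to sets.\<close>

lemma kwise_independent_family_constant:
  assumes "kwise_independent_family \<kappa> X R H" "B \<subseteq> X" "card B = \<kappa>" "finite B" "r \<in> R"
  shows "measure_pmf.prob (pmf_of_multiset H) {h. \<forall>x\<in>B. h x = r} = 1 / real (card R) ^ \<kappa>"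
proof -
  obtain e where e: "bij_betw e {..<\<kappa>} B"
    using assms(3,4) by (metis card_lessThan finite_lessThan finite_same_card_bij)
  have "{h. \<forall>x\<in>B. h x = r} = {h. \<forall>i<\<kappa>. h (e i) = (\<lambda>_. r) i}"
    using bij_betw_imp_surj_on[OF e] by auto
  moreover have "inj_on e {..<\<kappa>}" "e \<in> {..<\<kappa>} \<rightarrow> X"
    using e assms(2) by (auto simp: bij_betw_def)
  ultimately show ?thesis
    using assms(1,5) unfolding kwise_independent_family_def by fastforce
qed

text \<open>An overloaded value \<open>r\<close> contains a \<open>\<kappa>\<close>-subset of
  \<open>A\<close> sent entirely to \<open>r\<close>, so a union bound over pairs of a value and a
  \<open>\<kappa>\<close>-subset applies.\<close>

lemma kwise_independent_family_overload_le:
  assumes "kwise_independent_family \<kappa> X R H" "A \<subseteq> X" "finite A" "finite R"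
  shows "measure_pmf.prob (pmf_of_multiset H) {h. \<exists>r\<in>R. card {x \<in> A. h x = r} \<ge> \<kappa>}
    \<le> real (card R) * (real (card A choose \<kappa>) / real (card R) ^ \<kappa>)"
proof -
  define Q where "Q = R \<times> {B. B \<subseteq> A \<and> card B = \<kappa>}"
  have fin: "finite Q"
    using assms(3,4) by (simp add: Q_def)
  have "{h. \<exists>r\<in>R. card {x \<in> A. h x = r} \<ge> \<kappa>} \<subseteq> (\<Union>q\<in>Q. {h. \<forall>x\<in>snd q. h x = fst q})"
  proof
    fix h assume "h \<in> {h. \<exists>r\<in>R. card {x \<in> A. h x = r} \<ge> \<kappa>}"
    then obtain r where r: "r \<in> R" "card {x \<in> A. h x = r} \<ge> \<kappa>"
      by auto
    then obtain B where "B \<subseteq> {x \<in> A. h x = r}" "card B = \<kappa>"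
      by (meson obtain_subset_with_card_n)
    then show "h \<in> (\<Union>q\<in>Q. {h. \<forall>x\<in>snd q. h x = fst q})"
      using r by (intro UN_I[of "(r, B)"]) (auto simp: Q_def)
  qed
  then have "measure_pmf.prob (pmf_of_multiset H) {h. \<exists>r\<in>R. card {x \<in> A. h x = r} \<ge> \<kappa>}
      \<le> measure_pmf.prob (pmf_of_multiset H) (\<Union>q\<in>Q. {h. \<forall>x\<in>snd q. h x = fst q})"
    by (intro measure_pmf.finite_measure_mono) auto
  also have "\<dots> \<le> (\<Sum>q\<in>Q. measure_pmf.prob (pmf_of_multiset H) {h. \<forall>x\<in>snd q. h x = fst q})"
    using fin by (intro measure_pmf.finite_measure_subadditive_finite) auto
  also have "\<dots> = (\<Sum>q\<in>Q. 1 / real (card R) ^ \<kappa>)"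
    using assms by (intro sum.cong refl kwise_independent_family_constant[OF assms(1)])
      (auto simp: Q_def intro: finite_subset[OF _ assms(3)])
  also have "\<dots> = real (card R) * (real (card A choose \<kappa>) / real (card R) ^ \<kappa>)"
    using n_subsets[OF assms(3), of \<kappa>] by (simp add: Q_def card_cartesian_product)
  finally show ?thesis .
qed

section \<open>Bit strings and mixed-radix cell numbers\<close>

lemma finite_bitstrings: "finite (bitstrings m)"
  and card_bitstrings: "card (bitstrings m) = 2 ^ m"
  using finite_lists_length_eq[of "UNIV :: bool set" m] card_lists_length_eq[of "UNIV :: bool set" m]
  by (auto simp: bitstrings_def)

lemma bin_in_bitstrings: "bin m x \<in> bitstrings m"
  by (simp add: bin_def bitstrings_def)

lemma unbin_bin: "x < 2 ^ m \<Longrightarrow> unbin (bin m x) = x"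
  using bin_eq_iff_unbin[OF bin_in_bitstrings] by metis

lemma unbin_less: "bs \<in> bitstrings m \<Longrightarrow> unbin bs < 2 ^ m"
  using horner_sum_of_bool_2_less[of "rev bs"] by (simp add: unbin_def bitstrings_def)

text \<open>Reduction modulo \<open>t\<close>, then modulo \<open>s\<close>, recovers the digits.
  Hence a cell number determines its bucket, list position and hash value.\<close>

lemma mixed_radix_eqD:
  fixes r s t i p j q :: nat
  assumes "r * s * t + i * t + p = j * s * t + l * t + q" "i < s" "l < s" "p < t" "q < t"
  shows "r = j \<and> i = l \<and> p = q"
proof -
  have eq: "(r * s + i) * t + p = (j * s + l) * t + q"
    using assms(1) by (simp add: algebra_simps)
  then have "p = q"
    using assms by (metis mod_less mod_mult_self3)
  then have "r * s + i = j * s + l"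
    using eq assms by simp
  then have "i = l"
    using assms by (metis mod_less mod_mult_self3)
  then show ?thesis
    using \<open>r * s + i = j * s + l\<close> \<open>p = q\<close> assms by simp
qed

lemma mixed_radix_less:
  fixes r s t i p j :: nat
  assumes "r < j" "i < s" "p < t"
  shows "r * s * t + i * t + p < j * s * t"
proof -
  have "r * s * t + i * t + p < (r * s + i + 1) * t"
    using assms by (simp add: algebra_simps)
  also have "\<dots> \<le> ((r + 1) * s) * t"
    using assms by (intro mult_right_mono) (auto simp: algebra_simps)
  also have "\<dots> \<le> j * s * t"
    using assms by (intro mult_right_mono) auto
  finally show ?thesis .
qed

section \<open>Disjoint cells from bucketwise injective functions\<close>

text \<open>The deterministic part. Fix in each bucket one position whose function is injective on
  the keys of \<open>S\<close> there. The cells of these functions are fibres over the whole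
  universe, and distinct keys of \<open>S\<close> lie in distinct fibres.\<close>

lemma disjoint_cells_exist:
  fixes S :: "nat set"
  assumes f: "f \<in> bitstrings u \<rightarrow> bitstrings d"
    and len: "\<And>j. j < 2 ^ d \<Longrightarrow> length (F j) = d2"
    and ran: "\<And>j h. j < 2 ^ d \<Longrightarrow> h \<in> set (F j) \<Longrightarrow> h \<in> {..<n} \<rightarrow> {..<d3}"
    and inj: "\<And>j. j < 2 ^ d \<Longrightarrow> \<exists>h\<in>set (F j). inj_on h {x \<in> S. unbin (f (bin u x)) = j}"
    and S: "S \<subseteq> {..<n}" "card S = k"
  shows "\<exists>idx. (\<forall>j<k. idx j < 2 ^ d * d2 * d3) \<and>
     (\<forall>j<k. card (T n u d2 d3 f F (idx j) \<inter> S) = 1) \<and>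
     S \<subseteq> (\<Union>j<k. T n u d2 d3 f F (idx j)) \<and>
     (\<forall>j<k. \<forall>l<k. j \<noteq> l \<longrightarrow> T n u d2 d3 f F (idx j) \<inter> T n u d2 d3 f F (idx l) = {})"
proof -
  define J where "J x = unbin (f (bin u x))" for x
  \<comment> \<open>This holds for every natural number, since \<open>bin u x\<close> always has
    \<open>u\<close> bits.\<close>
  have J: "J x < 2 ^ d" for x
    using f bin_in_bitstrings[of u x] by (auto simp: J_def intro!: unbin_less)
  have "\<forall>j. \<exists>i. j < 2 ^ d \<longrightarrow> i < d2 \<and> inj_on (F j ! i) {x \<in> S. J x = j}"
    using inj len unfolding J_def by (metis in_set_conv_nth)
  then obtain i where i: "\<And>j. j < 2 ^ d \<Longrightarrow> i j < d2"
      "\<And>j. j < 2 ^ d \<Longrightarrow> inj_on (F j ! i j) {x \<in> S. J x = j}"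
    by metis
  have val: "(F (J x) ! l) y < d3" if "l < d2" "y < n" for x y l
  proof -
    have "F (J x) ! l \<in> set (F (J x))"
      using that len[OF J] by simp
    then show ?thesis
      using ran[OF J] that by blast
  qed
  define c where "c x = J x * d2 * d3 + i (J x) * d3 + (F (J x) ! i (J x)) x" for x
  have T_iff: "y \<in> T n u d2 d3 f F (c x) \<longleftrightarrow>
      y < n \<and> J y = J x \<and> (F (J x) ! i (J x)) y = (F (J x) ! i (J x)) x" if x: "x < n" for x y
  proof
    assume "y \<in> T n u d2 d3 f F (c x)"
    then obtain l where l: "y < n" "l \<in> {1..d2}"
        "c x = J y * d2 * d3 + (l - 1) * d3 + (F (J y) ! (l - 1)) y"
      by (auto simp: T_def G_def Let_def J_def)
    moreover have "l - 1 < d2"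
      using l(2) by auto
    \<comment> \<open>Equal cell numbers force the same list position, so \<open>y\<close> is hashed
      by the function selected for \<open>x\<close>.\<close>
    ultimately have "J x = J y \<and> i (J x) = l - 1 \<and> (F (J x) ! i (J x)) x = (F (J y) ! (l - 1)) y"
      using x i(1)[OF J] by (intro mixed_radix_eqD[OF l(3)[unfolded c_def]] val) auto
    then show "y < n \<and> J y = J x \<and> (F (J x) ! i (J x)) y = (F (J x) ! i (J x)) x"
      using l(1) by metis
  next
    assume y: "y < n \<and> J y = J x \<and> (F (J x) ! i (J x)) y = (F (J x) ! i (J x)) x"
    \<comment> \<open>\<open>G\<close> counts functions from \<open>1\<close> and list positions
      start at \<open>0\<close>, hence the witness \<open>Suc (i (J x))\<close>.\<close>
    then show "y \<in> T n u d2 d3 f F (c x)"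
      using i(1)[OF J, of x]
      by (auto simp: T_def G_def Let_def c_def simp flip: J_def
          intro!: image_eqI[where x = "Suc (i (J x))"])
  qed
  have sep: "x = y" if "x \<in> S" "y \<in> S" "J y = J x"
      "(F (J x) ! i (J x)) y = (F (J x) ! i (J x)) x" for x y
    using inj_onD[OF i(2)[OF J, of x], of x y] that by auto
  have "finite S"
    using S(1) finite_subset by blast
  then obtain e where e: "bij_betw e {..<k} S"
    using S(2) by (metis card_lessThan finite_lessThan finite_same_card_bij)
  have eS: "e j \<in> S" "e j < n" if "j < k" for j
    using e S(1) that by (auto simp: bij_betw_def)
  have "T n u d2 d3 f F (c (e j)) \<inter> S = {e j}" if "j < k" for j
    using eS[OF that] by (auto simp: T_iff intro: sep[symmetric])
  moreover have "c (e j) < 2 ^ d * d2 * d3" if "j < k" for j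
    unfolding c_def using eS[OF that] i(1)[OF J] J by (intro mixed_radix_less val) auto
  moreover have "S \<subseteq> (\<Union>j<k. T n u d2 d3 f F (c (e j)))"
  proof
    fix x assume x: "x \<in> S"
    then obtain j where "j < k" "x = e j"
      using e by (auto simp: bij_betw_def)
    then show "x \<in> (\<Union>j<k. T n u d2 d3 f F (c (e j)))"
      using eS by (auto simp: T_iff)
  qed
  moreover have "T n u d2 d3 f F (c (e j)) \<inter> T n u d2 d3 f F (c (e l)) = {}"
    if "j < k" "l < k" "j \<noteq> l" for j l
  proof (rule ccontr)
    assume "T n u d2 d3 f F (c (e j)) \<inter> T n u d2 d3 f F (c (e l)) \<noteq> {}"
    \<comment> \<open>The common key \<open>y\<close> may lie outside \<open>S\<close>; it only
      transfers bucket and hash value between \<open>e j\<close> and \<open>e l\<close>, to which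
      injectivity applies.\<close>
    then obtain y where "y \<in> T n u d2 d3 f F (c (e j))" "y \<in> T n u d2 d3 f F (c (e l))"
      by auto
    then have "J (e l) = J (e j) \<and>
        (F (J (e j)) ! i (J (e j))) (e l) = (F (J (e j)) ! i (J (e j))) (e j)"
      using eS that T_iff by metis
    then have "e j = e l"
      using sep eS that by blast
    then show False
      using e that by (auto simp: bij_betw_def inj_on_def)
  qed
  ultimately show ?thesis
    by (intro exI[of _ "\<lambda>j. c (e j)"]) auto
qed

section \<open>Combining the two failure probabilities\<close>

theorem theorem6:
  fixes n k u d d1 d2 d3 :: nat
    and HF :: "(bool list \<Rightarrow> bool list) multiset"
    and H' :: "(nat \<Rightarrow> nat) multiset"
    and arrange :: "nat \<Rightarrow> (nat \<Rightarrow> nat) list \<Rightarrow> (nat \<Rightarrow> nat) list"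
    and S :: "nat set"
  assumes "n > 1" and "k \<ge> 2"
    and "u > 0" and "2 ^ (u - 1) < n" and "n \<le> 2 ^ u"
    and "d > 0" and "2 ^ (d - 1) < real k / ln (real k)" and "real k / ln (real k) \<le> 2 ^ d"
    and "d1 = 2 ^ d"
    and "d2 = nat \<lceil>8 * ln (real k)\<rceil>"
    and "d3 = (nat \<lceil>13 * ln (real k)\<rceil>)\<^sup>2"
    and "kwise_independent_family (nat \<lceil>12 * ln (real k)\<rceil>) (bitstrings u) (bitstrings d) HF"
    and "universal_family {..<n} d3 H'"
    and arrange: "\<And>j hs. mset (arrange j hs) = mset hs"
    and "S \<subseteq> {..<n}" and "card S = k"
  shows "measure_pmf.prob (construction_pmf HF H' d1 d2)
      {(f, F). \<exists>idx :: nat \<Rightarrow> nat.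
         let T' = T n u d2 d3 f (\<lambda>j. arrange j (F j)) in
           (\<forall>j<k. idx j < d1 * d2 * d3) \<and>
           (\<forall>j<k. card (T' (idx j) \<inter> S) = 1) \<and>
           S \<subseteq> (\<Union>j<k. T' (idx j)) \<and>
           (\<forall>j<k. \<forall>l<k. j \<noteq> l \<longrightarrow> T' (idx j) \<inter> T' (idx l) = {})}
    \<ge> 1 - 4 / (real k ^ 3 * ln (real k))"
proof -
  define L where "L = ln (real k)"
  define \<kappa> where "\<kappa> = nat \<lceil>12 * L\<rceil>"
  define m where "m = nat \<lceil>13 * L\<rceil>"
  define HP where "HP = pmf_of_multiset HF"
  define Q where "Q = Pi_pmf {..<d1} [] (\<lambda>_. replicate_pmf d2 (pmf_of_multiset H'))"
  define J where "J f x = unbin (f (bin u x))" for f x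
  define good where "good = {(f, F). \<exists>idx :: nat \<Rightarrow> nat.
         let T' = T n u d2 d3 f (\<lambda>j. arrange j (F j)) in
           (\<forall>j<k. idx j < d1 * d2 * d3) \<and>
           (\<forall>j<k. card (T' (idx j) \<inter> S) = 1) \<and>
           S \<subseteq> (\<Union>j<k. T' (idx j)) \<and>
           (\<forall>j<k. \<forall>l<k. j \<noteq> l \<longrightarrow> T' (idx j) \<inter> T' (idx l) = {})}"
  define over where "over = {f. \<exists>r\<in>bitstrings d. card {z \<in> bin u ` S. f z = r} \<ge> \<kappa>}"
  have L: "L > 0"
    using assms(2) by (simp add: L_def)
  \<comment> \<open>Passing from \<open>12\<close> to \<open>13\<close> ensures that a load below
    \<open>\<kappa>\<close> is within the size \<open>m\<close> for which the range
    \<open>m\<^sup>2\<close> suffices.\<close>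
  have \<kappa>: "12 * L \<le> real \<kappa>" and "\<kappa> \<le> m"
    using L unfolding \<kappa>_def m_def by linarith+
  have d2: "8 * L \<le> real d2"
    using L unfolding assms L_def by linarith
  have finS: "finite S"
    using assms finite_subset by blast
  have HF: "hash_family (bitstrings u) (bitstrings d) HF"
    and kwise: "kwise_independent_family \<kappa> (bitstrings u) (bitstrings d) HF"
    using assms by (auto simp: kwise_independent_family_def \<kappa>_def L_def)
  have univ: "universal_family {..<n} (m\<^sup>2) H'" and H': "hash_family {..<n} {..<d3} H'"
    using assms by (auto simp: universal_family_def m_def L_def)
  have inj_bin: "inj_on (bin u) S"
    using assms(5,15) by (intro inj_on_inverseI[where g = unbin] unbin_bin) auto
  have kN: "real k \<le> L * 2 ^ d"
    using assms(8) L by (simp add: L_def field_simps)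
  \<comment> \<open>Minimality of \<open>d\<close> keeps the number of buckets within a factor
    \<open>2\<close> of \<open>k / L\<close>.\<close>
  have "2 * (2 :: real) ^ (d - 1) = 2 ^ d"
    using assms(6) by (simp flip: power_Suc)
  then have d1: "real d1 \<le> 2 * real k / L"
    using assms(7,9) by (simp add: L_def)

  have over_le: "measure_pmf.prob HP over \<le> real d1 * exp (- 4 * L)"
  proof -
    have "measure_pmf.prob HP over \<le> real d1 * (real (k choose \<kappa>) / (2 ^ d) ^ \<kappa>)"
      using kwise_independent_family_overload_le[OF kwise _ finite_imageI[OF finS] finite_bitstrings,
          of "bin u"] bin_in_bitstrings
      by (simp add: image_subset_iff card_image[OF inj_bin] card_bitstrings HP_def over_def assms(9,16))
    also have "\<dots> \<le> real d1 * exp (- real \<kappa>)"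
      using kN \<kappa> by (intro mult_left_mono binomial_div_power_le_exp) auto
    \<comment> \<open>Weakened deliberately, so that both failure events get the same bound.\<close>
    also have "\<dots> \<le> real d1 * exp (- 4 * L)"
      using \<kappa> L by (intro mult_left_mono) auto
    finally show ?thesis .
  qed

  have bad_le: "measure_pmf.prob Q {F. (f, F) \<in> - good} \<le> real d1 * exp (- 4 * L)"
    if f: "f \<in> set_pmf HP" "f \<notin> over" for f
  proof -
    have fr: "f \<in> bitstrings u \<rightarrow> bitstrings d"
      using f hash_family_set_pmf[OF HF] by (simp add: HP_def)
    have small: "card {x \<in> S. J f x = j} \<le> m" if j: "j < d1" for j
    proof -
      \<comment> \<open>Bucket numbers are translated back to bit strings, in which
        \<open>over\<close> is phrased.\<close>
      have "J f x = j \<longleftrightarrow> f (bin u x) = bin d j" for x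
        using bin_eq_iff_unbin[OF funcset_mem[OF fr bin_in_bitstrings], of j x] j assms(9)
        unfolding J_def by metis
      then have "bin u ` {x \<in> S. J f x = j} = {z \<in> bin u ` S. f z = bin d j}"
        by auto
      then have "card {x \<in> S. J f x = j} = card {z \<in> bin u ` S. f z = bin d j}"
        using card_image[OF inj_on_subset[OF inj_bin], of "{x \<in> S. J f x = j}"] by auto
      also have "\<dots> < \<kappa>"
        using f(2) bin_in_bitstrings[of d j] by (force simp: over_def)
      finally show ?thesis
        using \<open>\<kappa> \<le> m\<close> by simp
    qed
    have "measure_pmf.prob Q {F. (f, F) \<in> - good}
        \<le> measure_pmf.prob Q {F. \<exists>j\<in>{..<d1}. \<forall>h\<in>set (F j). \<not> inj_on h {x \<in> S. J f x = j}}"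
    proof (rule measure_pmf.finite_measure_mono_AE)
      \<comment> \<open>The inclusion is needed only on the support of \<open>Q\<close>, where each
        \<open>F j\<close> is a list of \<open>d2\<close> members of \<open>H'\<close>.\<close>
      show "AE F in measure_pmf Q. F \<in> {F. (f, F) \<in> - good} \<longrightarrow>
          F \<in> {F. \<exists>j\<in>{..<d1}. \<forall>h\<in>set (F j). \<not> inj_on h {x \<in> S. J f x = j}}"
        unfolding AE_measure_pmf_iff
      proof (intro ballI impI, rule ccontr)
        fix F assume F: "F \<in> set_pmf Q" "F \<in> {F. (f, F) \<in> - good}"
          "F \<notin> {F. \<exists>j\<in>{..<d1}. \<forall>h\<in>set (F j). \<not> inj_on h {x \<in> S. J f x = j}}"
        have Fj: "F j \<in> set_pmf (replicate_pmf d2 (pmf_of_multiset H'))" if "j < d1" for j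
          using F(1) that by (auto simp: Q_def set_Pi_pmf PiE_dflt_def)
        \<comment> \<open>Reordering keeps members and length, so an injective member survives at
          some position.\<close>
        have set_arr: "set (arrange j hs) = set hs" and len_arr: "length (arrange j hs) = length hs"
          for j hs
          using arrange[of j hs] mset_eq_setD mset_eq_length by blast+
        have "(f, F) \<in> good"
          using disjoint_cells_exist[OF fr, of "\<lambda>j. arrange j (F j)" d2 n d3 S k]
            F(3) Fj hash_family_set_pmf[OF H'] assms(9,15,16)
          unfolding good_def Let_def J_def
          by (auto simp: set_arr len_arr set_replicate_pmf lists_eq_set subset_iff)
        then show False
          using F(2) by simp
      qed
    qed auto
    also have "\<dots> \<le> real (card {..<d1}) * (1 / 2) ^ d2"
      unfolding Q_def
    proof (rule prob_Pi_pmf_ex_le)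
      fix j assume "j \<in> {..<d1}"
      then show "measure_pmf.prob (replicate_pmf d2 (pmf_of_multiset H'))
          {hs. \<forall>h\<in>set hs. \<not> inj_on h {x \<in> S. J f x = j}} \<le> (1 / 2) ^ d2"
        unfolding prob_replicate_pmf_all using finS assms(15) small
        by (intro power_mono universal_family_not_inj_on_le[OF univ]) auto
    qed auto
    also have "\<dots> \<le> real d1 * exp (- 4 * L)"
      using half_power_le_exp[OF d2] by (simp add: mult_left_mono)
    finally show ?thesis .
  qed

  have exp4: "exp (- 4 * L) = 1 / real k ^ 4"
  proof -
    have "exp (4 * L) = real k ^ 4"
      using assms(2) by (simp add: L_def exp_of_nat_mult[of 4, simplified])
    then show ?thesis
      by (simp add: exp_minus inverse_eq_divide)
  qed
  have "measure_pmf.prob (construction_pmf HF H' d1 d2) (- good)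
      \<le> measure_pmf.prob HP over + real d1 * exp (- 4 * L)"
    unfolding construction_pmf_def HP_def[symmetric] Q_def[symmetric]
    by (intro prob_pair_pmf_le bad_le) auto
  also have "\<dots> \<le> 2 * (real d1 * exp (- 4 * L))"
    using over_le by simp
  \<comment> \<open>One factor \<open>2\<close> counts the failure events, the other comes from
    rounding \<open>d1\<close> up to a power of two.\<close>
  also have "\<dots> \<le> 2 * (2 * real k / L * exp (- 4 * L))"
    using d1 by (intro mult_left_mono mult_right_mono) auto
  also have "\<dots> = 4 / (real k ^ 3 * L)"
    unfolding exp4 using assms(2) by (simp add: field_simps power_numeral_reduce)
  finally have "measure_pmf.prob (construction_pmf HF H' d1 d2) (- good) \<le> 4 / (real k ^ 3 * L)" .
  moreover have "measure_pmf.prob (construction_pmf HF H' d1 d2) (- good)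
      = 1 - measure_pmf.prob (construction_pmf HF H' d1 d2) good"
    using measure_pmf.prob_compl[of good] by (simp add: Compl_eq_Diff_UNIV)
  ultimately show ?thesis
    unfolding good_def[symmetric] L_def by linarith
qed

end
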